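(* Let $(X,d,\mu)$ be a metric measure space. The measure $\mu$ is semilocally doubling on $X$ if and only if (its zero extension) is semilocally doubling on the completion $\widehat X$.
   Context: $X=(X,d,\mu)$ is a metric space with a positive complete Borel measure $\mu$ such that $0<\mu(B)<\infty$ for all balls $B$. Balls are open; a ball $B$ comes with a predetermined centre and radius, and $2B$ is the concentric ball with twice the radius. $\widehat X$ is the completion of $X$ with respect to $d$. A set $E\subset\widehat X$ is measurable iff $E\cap X$ is $\mu$-measurable, and $\mu$ is extended by $\mu(E)=\mu(E\cap X)$, so $\mu(\widehat X\setminus X)=0$. $\mu$ is doubling within a ball $B(x_0,r_0)$ if there is $C>0$ (depending on $x_0$ and $r_0$) such that $\mu(2B)\le C\mu(B)$ for all balls $B\subset B(x_0,r_0)$. $\mu$ is semilocally doubling on a space if it is doubling within every ball of that space. *)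

theory Defs
  imports "HOL-Analysis.Analysis"
begin

text \<open>
  A complete Borel measure lives on a \<open>\<sigma>\<close>-algebra that contains the Borel sets but may be larger
  than the Borel \<open>\<sigma>\<close>-algebra, so only the inclusion is required. Positivity of the measure is part
  of the type \<open>measure\<close>, whose values are extended nonnegative reals.
\<close>

locale metric_measure_space = Metric_space X d + complete_measure \<mu>
  for X :: "'a set" and d :: "'a \<Rightarrow> 'a \<Rightarrow> real" and \<mu> :: "'a measure" +
  assumes space_eq: "space \<mu> = X"
    and borel_sets: "sigma_sets X {U. openin mtopology U} \<subseteq> sets \<mu>"
    and mball_pos: "\<lbrakk>x \<in> X; 0 < r\<rbrakk> \<Longrightarrow> 0 < emeasure \<mu> (mball x r)"
    and mball_finite: "\<lbrakk>x \<in> X; 0 < r\<rbrakk> \<Longrightarrow> emeasure \<mu> (mball x r) < \<infinity>"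

text \<open>
  The completion is determined up to isometry only, so it is given here by its defining property: a
  complete metric space \<open>Y\<close> together with an isometric embedding \<open>\<iota>\<close> of \<open>X\<close> onto a dense subset.
\<close>

locale metric_completion = X: Metric_space X d + Y: Metric_space Y e
  for X :: "'a set" and d :: "'a \<Rightarrow> 'a \<Rightarrow> real"
    and Y :: "'b set" and e :: "'b \<Rightarrow> 'b \<Rightarrow> real" and \<iota> :: "'a \<Rightarrow> 'b" +
  assumes complete: "Y.mcomplete"
    and maps_into: "\<iota> \<in> X \<rightarrow> Y"
    and isometric: "\<lbrakk>x \<in> X; y \<in> X\<rbrakk> \<Longrightarrow> e (\<iota> x) (\<iota> y) = d x y"
    and dense: "Y.mtopology closure_of (\<iota> ` X) = Y"

lemma (in Metric_space) metric_completion_exists: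
  "\<exists>(Y :: ('a \<Rightarrow> real) set) e \<iota>. metric_completion M d Y e \<iota>"
proof -
  obtain \<iota> :: "'a \<Rightarrow> 'a \<Rightarrow> real" and m
    where m: "mcomplete_of m" "\<iota> \<in> M \<rightarrow> mspace m" "mtopology_of m closure_of \<iota> ` M = mspace m"
      "\<And>x y. \<lbrakk>x \<in> M; y \<in> M\<rbrakk> \<Longrightarrow> mdist m (\<iota> x) (\<iota> y) = d x y"
    by (rule metric_completion) blast
  have "metric_completion M d (mspace m) (mdist m) \<iota>"
    by (intro metric_completion.intro metric_completion_axioms.intro Metric_space_axioms
        Metric_space_mspace_mdist)
      (use m in \<open>auto simp: mcomplete_of_def mtopology_of_def\<close>)
  then show ?thesis by blast
qed

text \<open>
  The zero extension of \<open>\<mu>\<close> to \<open>Y\<close>. As \<open>X\<close> is identified with its image under \<open>\<iota>\<close>, the set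
  \<open>E \<inter> X\<close> for \<open>E \<subseteq> Y\<close> is \<open>\<iota> -` E \<inter> X\<close>.
\<close>

definition zero_extension :: "'a set \<Rightarrow> 'a measure \<Rightarrow> ('a \<Rightarrow> 'b) \<Rightarrow> 'b set \<Rightarrow> 'b measure" where
  "zero_extension X \<mu> \<iota> Y =
     measure_of Y {E. E \<subseteq> Y \<and> \<iota> -` E \<inter> X \<in> sets \<mu>} (\<lambda>E. emeasure \<mu> (\<iota> -` E \<inter> X))"

lemma space_zero_extension: "space (zero_extension X \<mu> \<iota> Y) = Y"
  unfolding zero_extension_def by (rule space_measure_of) auto

lemma
  assumes "space \<mu> = X" "\<iota> \<in> X \<rightarrow> Y"
  shows sets_zero_extension:
      "sets (zero_extension X \<mu> \<iota> Y) = {E. E \<subseteq> Y \<and> \<iota> -` E \<inter> X \<in> sets \<mu>}" (is ?S)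
    and emeasure_zero_extension:
      "\<lbrakk>E \<subseteq> Y; \<iota> -` E \<inter> X \<in> sets \<mu>\<rbrakk> \<Longrightarrow>
         emeasure (zero_extension X \<mu> \<iota> Y) E = emeasure \<mu> (\<iota> -` E \<inter> X)"
proof -
  let ?A = "{E. E \<subseteq> Y \<and> \<iota> -` E \<inter> X \<in> sets \<mu>}"
  interpret sigma_algebra Y ?A
    unfolding sigma_algebra_iff2
  proof (intro conjI ballI allI impI)
    fix E assume E: "E \<in> ?A"
    have "\<iota> -` (Y - E) \<inter> X = space \<mu> - \<iota> -` E \<inter> X"
      using assms by auto
    with E show "Y - E \<in> ?A" by auto
  next
    fix E :: "nat \<Rightarrow> _" assume E: "range E \<subseteq> ?A"
    have "\<iota> -` (\<Union>i. E i) \<inter> X = (\<Union>i. \<iota> -` E i \<inter> X)" by auto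
    moreover have "(\<Union>i. \<iota> -` E i \<inter> X) \<in> sets \<mu>"
      using E by (intro sets.countable_UN) auto
    ultimately have "\<iota> -` (\<Union>i. E i) \<inter> X \<in> sets \<mu>" by (simp only:)
    with E show "(\<Union>i. E i) \<in> ?A" by blast
  qed auto
  show S: ?S
    unfolding zero_extension_def by (simp add: sets_measure_of_eq)
  assume E: "E \<subseteq> Y" "\<iota> -` E \<inter> X \<in> sets \<mu>"
  show "emeasure (zero_extension X \<mu> \<iota> Y) E = emeasure \<mu> (\<iota> -` E \<inter> X)"
  proof (rule emeasure_measure_of[OF zero_extension_def])
    show "countably_additive (sets (zero_extension X \<mu> \<iota> Y)) (\<lambda>E. emeasure \<mu> (\<iota> -` E \<inter> X))"
      unfolding S
    proof (rule countably_additiveI)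
      fix F :: "nat \<Rightarrow> _"
      assume F: "range F \<subseteq> ?A" "disjoint_family F"
      have "(\<Sum>i. emeasure \<mu> (\<iota> -` F i \<inter> X)) = emeasure \<mu> (\<Union>i. \<iota> -` F i \<inter> X)"
        using F by (intro suminf_emeasure) (auto simp: disjoint_family_on_def, blast)
      also have "(\<Union>i. \<iota> -` F i \<inter> X) = \<iota> -` (\<Union>i. F i) \<inter> X" by auto
      finally show "(\<Sum>i. emeasure \<mu> (\<iota> -` F i \<inter> X)) = emeasure \<mu> (\<iota> -` (\<Union>i. F i) \<inter> X)" .
    qed
  qed (use E S in \<open>auto simp: positive_def\<close>)
qed

context Metric_space
begin

text \<open>
  Balls carry a centre and a radius, so quantifying over balls means quantifying over pairs
  \<open>(x, r)\<close>. The inclusion between balls is inclusion of sets; it does not bound \<open>r\<close> by \<open>r\<^sub>0\<close>.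
\<close>

definition doubling_within :: "'a measure \<Rightarrow> 'a \<Rightarrow> real \<Rightarrow> bool" where
  "doubling_within \<mu> x\<^sub>0 r\<^sub>0 \<longleftrightarrow>
     (\<exists>C::real. C > 0 \<and>
        (\<forall>x\<in>M. \<forall>r>0. mball x r \<subseteq> mball x\<^sub>0 r\<^sub>0 \<longrightarrow>
           emeasure \<mu> (mball x (2 * r)) \<le> ennreal C * emeasure \<mu> (mball x r)))"

definition semilocally_doubling :: "'a measure \<Rightarrow> bool" where
  "semilocally_doubling \<mu> \<longleftrightarrow> (\<forall>x\<^sub>0\<in>M. \<forall>r\<^sub>0>0. doubling_within \<mu> x\<^sub>0 r\<^sub>0)"

end

end

theory Submission
  imports Defs
begin

text \<open>
  The trace on \<open>X\<close> of a ball of \<open>Y\<close> centred at a point of \<open>X\<close> is the ball of \<open>X\<close> with the same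
  centre and radius, so doubling passes from \<open>Y\<close> to \<open>X\<close> at once by density. Conversely, a ball
  \<open>B(y, r)\<close> of \<open>Y\<close> is compared with balls centred at a point \<open>x\<close> of \<open>X\<close> at distance less than
  \<open>r/4\<close> from \<open>y\<close>: since \<open>B(x, 3r/4) \<subseteq> B(y, r)\<close> and \<open>B(y, 2r) \<subseteq> B(x, 3r)\<close>, doubling twice on \<open>X\<close>
  gives the bound. The second doubling needs \<open>B(x, 3r/2)\<close>, which sticks out of \<open>B(y, r)\<close>, to lie
  in a ball that is independent of \<open>y\<close> and \<open>r\<close>.
\<close>

text \<open>
  The radius \<open>r\<close> may exceed \<open>r\<^sub>0\<close> by far, so the triangle inequality alone does not give this. A
  point \<open>z\<close> outside \<open>B(y\<^sub>0, r\<^sub>0)\<close>, if there is one, bounds all admissible radii by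
  \<open>r\<^sub>0 + d y\<^sub>0 z\<close>.
\<close>

lemma (in Metric_space) doubled_subballs_bounded:
  assumes "y\<^sub>0 \<in> M" "0 < r\<^sub>0"
  obtains R where "0 < R"
    "\<And>y r. \<lbrakk>y \<in> M; 0 < r; mball y r \<subseteq> mball y\<^sub>0 r\<^sub>0\<rbrakk> \<Longrightarrow> mball y (2 * r) \<subseteq> mball y\<^sub>0 R"
proof (cases "M \<subseteq> mball y\<^sub>0 r\<^sub>0")
  case True
  \<comment> \<open>Admissible radii may be unbounded here, but every ball lies in \<open>M\<close>,
    which is contained in the given ball.\<close>
  then show ?thesis
    using that[of r\<^sub>0] assms mball_subset_mspace by blast
next
  case False
  then obtain z where z: "z \<in> M" "z \<notin> mball y\<^sub>0 r\<^sub>0" by blast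
  \<comment> \<open>The radius comes from \<open>d y\<^sub>0 y < r\<^sub>0\<close> and
    \<open>r \<le> r\<^sub>0 + d y\<^sub>0 z\<close>, inserted into
    \<open>d y\<^sub>0 y + 2 * r\<close>.\<close>
  show ?thesis
  proof (rule that[of "3 * r\<^sub>0 + 2 * d y\<^sub>0 z"])
    show "0 < 3 * r\<^sub>0 + 2 * d y\<^sub>0 z"
      using assms nonneg[of y\<^sub>0 z] by linarith
  next
    fix y r assume y: "y \<in> M" "0 < r" "mball y r \<subseteq> mball y\<^sub>0 r\<^sub>0"
    have y\<^sub>0y: "d y\<^sub>0 y < r\<^sub>0"
      using y centre_in_mball_iff by auto
    have "r \<le> d y z"
      using y z by (meson in_mball not_le subsetD)
    also have "\<dots> \<le> d y\<^sub>0 y + d y\<^sub>0 z"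
      using triangle[of y y\<^sub>0 z] commute[of y y\<^sub>0] y z assms by simp
    finally have "d y\<^sub>0 y + 2 * r \<le> 3 * r\<^sub>0 + 2 * d y\<^sub>0 z"
      using y\<^sub>0y by linarith
    then show "mball y (2 * r) \<subseteq> mball y\<^sub>0 (3 * r\<^sub>0 + 2 * d y\<^sub>0 z)"
      using assms y by (intro mball_subset) (simp_all add: commute)
  qed
qed

context metric_completion
begin

lemma \<iota>_in: "x \<in> X \<Longrightarrow> \<iota> x \<in> Y"
  using maps_into by blast

lemma dense_obtain:
  assumes "y \<in> Y" "0 < \<delta>"
  obtains x where "x \<in> X" "e y (\<iota> x) < \<delta>"
proof -
  have "y \<in> Y.mtopology closure_of (\<iota> ` X)"
    using assms dense by simp
  then show ?thesis
    using assms that by (force simp: Y.metric_closure_of)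
qed

lemma vimage_mball:
  assumes "x \<in> X"
  shows "\<iota> -` Y.mball (\<iota> x) r \<inter> X = X.mball x r"
  using assms isometric \<iota>_in by auto

text \<open>The centre \<open>y\<close> may lie outside the image of \<open>X\<close>, so the trace
  need not be a ball of \<open>X\<close>. Openness makes it measurable, as
  \<open>emeasure_zero_extension\<close> requires.\<close>

lemma openin_vimage_mball: "openin X.mtopology (\<iota> -` Y.mball y r \<inter> X)"
  unfolding X.openin_mtopology
proof (intro conjI allI impI)
  fix x assume x: "x \<in> \<iota> -` Y.mball y r \<inter> X"
  then have "Y.mball (\<iota> x) (r - e y (\<iota> x)) \<subseteq> Y.mball y r"
    by (intro Y.mball_subset) (auto simp: Y.commute)
  then have "X.mball x (r - e y (\<iota> x)) \<subseteq> \<iota> -` Y.mball y r \<inter> X"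
    using x vimage_mball[of x] by blast
  with x show "\<exists>s>0. X.mball x s \<subseteq> \<iota> -` Y.mball y r \<inter> X"
    by (intro exI[of _ "r - e y (\<iota> x)"]) auto
qed auto

text \<open>Each point of the left ball is close to a point of \<open>X\<close> in the same ball, to
  which the hypothesis applies. The radius \<open>s\<close> itself can fail: for \<open>X\<close> =
  (-1,1), the ball of radius 5 about 0 has trace inside the unit ball, but in [-1,1] it contains the
  endpoints.\<close>

lemma mball_subset_completion:
  assumes "x \<in> X" "x\<^sub>0 \<in> X" "0 < s" "X.mball x r \<subseteq> X.mball x\<^sub>0 s"
  shows "Y.mball (\<iota> x) r \<subseteq> Y.mball (\<iota> x\<^sub>0) (2 * s)"
proof
  fix y assume y: "y \<in> Y.mball (\<iota> x) r"
  \<comment> \<open>The second term of the minimum keeps \<open>\<iota> x'\<close> in the ball of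
    radius \<open>r\<close>; the first limits the cost of returning to \<open>y\<close> to
    \<open>s\<close>.\<close>
  then obtain x' where x': "x' \<in> X" "e y (\<iota> x') < min s (r - e (\<iota> x) y)"
    using dense_obtain[of y "min s (r - e (\<iota> x) y)"] assms by auto
  have "e (\<iota> x) (\<iota> x') < r"
    using Y.triangle[of "\<iota> x" y "\<iota> x'"] y x' \<iota>_in assms by auto
  then have "x' \<in> X.mball x\<^sub>0 s"
    using assms x' isometric by auto
  then have "e (\<iota> x\<^sub>0) (\<iota> x') < s"
    using isometric by auto
  then have "e (\<iota> x\<^sub>0) y < 2 * s"
    using Y.triangle[of "\<iota> x\<^sub>0" "\<iota> x'" y] Y.commute[of y "\<iota> x'"] y x' \<iota>_in assms by auto
  then show "y \<in> Y.mball (\<iota> x\<^sub>0) (2 * s)"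
    using y assms \<iota>_in by auto
qed

context
  fixes \<mu> :: "'a measure"
  assumes mms: "metric_measure_space X d \<mu>"
begin

interpretation metric_measure_space X d \<mu>
  by (rule mms)

lemma sets_openin: "openin X.mtopology U \<Longrightarrow> U \<in> sets \<mu>"
  using borel_sets by blast

lemma emeasure_zero_extension_mball:
  "emeasure (zero_extension X \<mu> \<iota> Y) (Y.mball y r) = emeasure \<mu> (\<iota> -` Y.mball y r \<inter> X)"
  by (intro emeasure_zero_extension space_eq maps_into Y.mball_subset_mspace sets_openin
      openin_vimage_mball)

lemma semilocally_doubling_if_completion:
  assumes "Y.semilocally_doubling (zero_extension X \<mu> \<iota> Y)"
  shows "X.semilocally_doubling \<mu>"
  unfolding X.semilocally_doubling_def
proof (intro ballI allI impI)
  fix x\<^sub>0 and r\<^sub>0 :: real assume x\<^sub>0: "x\<^sub>0 \<in> X" "0 < r\<^sub>0"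
  \<comment> \<open>The factor 2 absorbs the loss in \<open>mball_subset_completion\<close>; it is
    harmless because doubling holds within every ball of \<open>Y\<close>.\<close>
  then have "Y.doubling_within (zero_extension X \<mu> \<iota> Y) (\<iota> x\<^sub>0) (2 * r\<^sub>0)"
    using assms \<iota>_in by (simp add: Y.semilocally_doubling_def)
  then obtain C :: real where C: "0 < C"
    "\<And>y r. \<lbrakk>y \<in> Y; 0 < r; Y.mball y r \<subseteq> Y.mball (\<iota> x\<^sub>0) (2 * r\<^sub>0)\<rbrakk> \<Longrightarrow>
       emeasure \<mu> (\<iota> -` Y.mball y (2 * r) \<inter> X) \<le> ennreal C * emeasure \<mu> (\<iota> -` Y.mball y r \<inter> X)"
    unfolding Y.doubling_within_def emeasure_zero_extension_mball by blast
  have "emeasure \<mu> (X.mball x (2 * r)) \<le> ennreal C * emeasure \<mu> (X.mball x r)"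
    if "x \<in> X" "0 < r" "X.mball x r \<subseteq> X.mball x\<^sub>0 r\<^sub>0" for x r
    using C(2)[of "\<iota> x" r] that x\<^sub>0 \<iota>_in mball_subset_completion by (simp add: vimage_mball)
  with C(1) show "X.doubling_within \<mu> x\<^sub>0 r\<^sub>0"
    unfolding X.doubling_within_def by blast
qed

lemma semilocally_doubling_completion:
  assumes "X.semilocally_doubling \<mu>"
  shows "Y.semilocally_doubling (zero_extension X \<mu> \<iota> Y)"
  unfolding Y.semilocally_doubling_def
proof (intro ballI allI impI)
  fix y\<^sub>0 and r\<^sub>0 :: real assume y\<^sub>0: "y\<^sub>0 \<in> Y" "0 < r\<^sub>0"
  then obtain R where R: "0 < R"
    "\<And>y r. \<lbrakk>y \<in> Y; 0 < r; Y.mball y r \<subseteq> Y.mball y\<^sub>0 r\<^sub>0\<rbrakk> \<Longrightarrow> Y.mball y (2 * r) \<subseteq> Y.mball y\<^sub>0 R"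
    using Y.doubled_subballs_bounded by blast
  \<comment> \<open>Doubling on \<open>X\<close> needs a centre in \<open>X\<close>. As
    \<open>x\<^sub>0\<close> and \<open>R\<close> are fixed before \<open>y\<close> and
    \<open>r\<close>, one constant \<open>C\<close> serves all balls.\<close>
  obtain x\<^sub>0 where x\<^sub>0: "x\<^sub>0 \<in> X" "e y\<^sub>0 (\<iota> x\<^sub>0) < R"
    using dense_obtain y\<^sub>0 R by blast
  have R_sub: "Y.mball y\<^sub>0 R \<subseteq> Y.mball (\<iota> x\<^sub>0) (2 * R)"
    using x\<^sub>0 y\<^sub>0 \<iota>_in by (intro Y.mball_subset) (auto simp: Y.commute)
  have "X.doubling_within \<mu> x\<^sub>0 (2 * R)"
    using assms x\<^sub>0 R by (simp add: X.semilocally_doubling_def)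
  then obtain C :: real where C: "0 < C"
    "\<And>x r. \<lbrakk>x \<in> X; 0 < r; X.mball x r \<subseteq> X.mball x\<^sub>0 (2 * R)\<rbrakk> \<Longrightarrow>
       emeasure \<mu> (X.mball x (2 * r)) \<le> ennreal C * emeasure \<mu> (X.mball x r)"
    unfolding X.doubling_within_def by blast
  have "emeasure \<mu> (\<iota> -` Y.mball y (2 * r) \<inter> X)
      \<le> ennreal (C * C) * emeasure \<mu> (\<iota> -` Y.mball y r \<inter> X)"
    if y: "y \<in> Y" "0 < r" "Y.mball y r \<subseteq> Y.mball y\<^sub>0 r\<^sub>0" for y r
  proof -
    \<comment> \<open>The distance r/4 suits all three inclusions: 3r/4 + r/4 = r, 3r/2 + r/4 < 2r
      and 2r + r/4 < 3r. Two doublings lead from 3r/4 to 3r.\<close>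
    obtain x where x: "x \<in> X" "e y (\<iota> x) < r / 4"
      using dense_obtain[of y "r / 4"] y by auto
    have "Y.mball (\<iota> x) (3 * r / 2) \<subseteq> Y.mball y (2 * r)"
      using x y \<iota>_in by (intro Y.mball_subset) (auto simp: Y.commute)
    with R(2)[OF y] R_sub have "Y.mball (\<iota> x) (3 * r / 2) \<subseteq> Y.mball (\<iota> x\<^sub>0) (2 * R)"
      by blast
    then have large: "X.mball x (3 * r / 2) \<subseteq> X.mball x\<^sub>0 (2 * R)"
      using vimage_mball[OF x(1)] vimage_mball[OF x\<^sub>0(1)] by blast
    then have small: "X.mball x (3 * r / 4) \<subseteq> X.mball x\<^sub>0 (2 * R)"
      using X.mball_subset_concentric[of "3 * r / 4" "3 * r / 2" x] y(2) by auto
    have "Y.mball y (2 * r) \<subseteq> Y.mball (\<iota> x) (3 * r)"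
      using x y \<iota>_in by (intro Y.mball_subset) auto
    then have "emeasure \<mu> (\<iota> -` Y.mball y (2 * r) \<inter> X) \<le> emeasure \<mu> (X.mball x (3 * r))"
      using vimage_mball[OF x(1)] by (intro emeasure_mono sets_openin X.openin_mball) blast
    also have "\<dots> \<le> ennreal C * emeasure \<mu> (X.mball x (3 * r / 2))"
      using C(2)[OF x(1) _ large] y(2) by simp
    also have "\<dots> \<le> ennreal C * (ennreal C * emeasure \<mu> (X.mball x (3 * r / 4)))"
      using C(2)[OF x(1) _ small] y(2) by (intro mult_left_mono) simp_all
    also have "\<dots> = ennreal (C * C) * emeasure \<mu> (X.mball x (3 * r / 4))"
      using C(1) by (simp add: ennreal_mult mult.assoc)
    also have "\<dots> \<le> ennreal (C * C) * emeasure \<mu> (\<iota> -` Y.mball y r \<inter> X)"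
    proof (intro mult_left_mono emeasure_mono sets_openin openin_vimage_mball)
      have "Y.mball (\<iota> x) (3 * r / 4) \<subseteq> Y.mball y r"
        using x y \<iota>_in by (intro Y.mball_subset) (auto simp: Y.commute)
      then show "X.mball x (3 * r / 4) \<subseteq> \<iota> -` Y.mball y r \<inter> X"
        using vimage_mball[OF x(1)] by blast
    qed simp
    finally show ?thesis .
  qed
  moreover have "0 < C * C" using C(1) by simp
  ultimately show "Y.doubling_within (zero_extension X \<mu> \<iota> Y) y\<^sub>0 r\<^sub>0"
    unfolding Y.doubling_within_def emeasure_zero_extension_mball by blast
qed

end

end

theorem corollary3p4:
  fixes X :: "'a set" and d :: "'a \<Rightarrow> 'a \<Rightarrow> real" and \<mu> :: "'a measure"
    and Y :: "'b set" and e :: "'b \<Rightarrow> 'b \<Rightarrow> real" and \<iota> :: "'a \<Rightarrow> 'b"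
  assumes "metric_measure_space X d \<mu>"
    and "metric_completion X d Y e \<iota>"
  shows "Metric_space.semilocally_doubling X d \<mu> \<longleftrightarrow>
         Metric_space.semilocally_doubling Y e (zero_extension X \<mu> \<iota> Y)"
  using metric_completion.semilocally_doubling_completion[OF assms(2,1)]
    metric_completion.semilocally_doubling_if_completion[OF assms(2,1)]
  by blast

end
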